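(* Let $V$ be a $k$-vector space. If $\varphi\in\operatorname{End}_k(V)$ is a core-nilpotent endomorphism of index $m$, then its pointwise Drazin inverse $\varphi^d$ satisfies $$\varphi^{m+1}\circ\varphi^d=\varphi^m.$$ In particular, $\varphi^d$ is the Drazin inverse of $\varphi$.
   Context: $k$ is a field and $V$ is an arbitrary (possibly infinite-dimensional) $k$-vector space. The endomorphism $\varphi$ makes $V$ a $k[x]$-module via $x\cdot v:=\varphi(v)$. $V_x$ denotes the localization of $V$ at the multiplicative system $S_x=\{1,x,x^2,\dots\}$, and $\phi\colon V\to V_x$, $v\mapsto v/1$, is the localization morphism. The index $i(f)$ of $f\in\operatorname{End}_k(V)$ is $0$ if $f$ is an automorphism; otherwise it is the smallest positive integer $m$ (if one exists) such that $\operatorname{Ker}(f^m)=\operatorname{Ker}(f^{m+1})$ and $\operatorname{Im}(f^m)=\operatorname{Im}(f^{m+1})$. An endomorphism $\varphi$ is core-nilpotent when there exist $\varphi_1,\varphi_2\in\operatorname{End}_k(V)$ with $\varphi=\varphi_1+\varphi_2$, $i(\varphi_1)\le 1$ (the index exists and is at most $1$), $\varphi_2$ nilpotent, and $\varphi_1\circ\varphi_2=0=\varphi_2\circ\varphi_1$. It is known that the index of $\varphi$ exists if and only if $\varphi$ is core-nilpotent. A pointwise Drazin inverse of $\varphi$ is an endomorphism $\varphi^d$ of $V$ satisfying $\varphi^d\circ\varphi\circ\varphi^d=\varphi^d$, $\varphi^d\circ\varphi=\varphi\circ\varphi^d$ and $\phi\circ\varphi\circ\varphi^d=\phi$. When $\phi\colon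 V\to V_x$ is surjective and has a $k[x]$-linear section $\sigma\colon V_x\to V$ (as is the case for core-nilpotent $\varphi$), it is given by $\varphi^d=\sigma\circ\varphi_x^{-1}\circ\phi$, where $\varphi_x\colon V_x\to V_x$ is the automorphism induced by $\varphi$ (multiplication by $x$). The Drazin inverse of a core-nilpotent endomorphism $\varphi$ of index $m$ is the unique endomorphism $\varphi^D$ of $V$ satisfying $\varphi^D\circ\varphi\circ\varphi^D=\varphi^D$, $\varphi^D\circ\varphi=\varphi\circ\varphi^D$ and $\varphi^{m+1}\circ\varphi^D=\varphi^m$. *)

theory Defs
  imports "HOL-Computational_Algebra.Polynomial"
begin

section \<open>Localization of a module at a multiplicative system\<close>

text \<open>
  A module structure is given, as in the library locale \<^locale>\<open>module\<close>, by its scalar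
  multiplication \<open>act\<close>.  The fraction \<open>v / s\<close> is the equivalence class of \<open>(v, s)\<close>.
\<close>

definition loc_rel ::
  "('r::comm_ring_1 \<Rightarrow> 'v::ab_group_add \<Rightarrow> 'v) \<Rightarrow> 'r set \<Rightarrow> (('v \<times> 'r) \<times> ('v \<times> 'r)) set" where
  "loc_rel act S =
     {((v, s), (w, t)) |v s w t. s \<in> S \<and> t \<in> S \<and> (\<exists>u\<in>S. act u (act t v - act s w) = 0)}"

definition localization ::
  "('r::comm_ring_1 \<Rightarrow> 'v::ab_group_add \<Rightarrow> 'v) \<Rightarrow> 'r set \<Rightarrow> ('v \<times> 'r) set set" where
  "localization act S = (UNIV \<times> S) // loc_rel act S"

definition loc_frac ::
  "('r::comm_ring_1 \<Rightarrow> 'v::ab_group_add \<Rightarrow> 'v) \<Rightarrow> 'r set \<Rightarrow> 'v \<Rightarrow> 'r \<Rightarrow> ('v \<times> 'r) set" where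
  "loc_frac act S v s = loc_rel act S `` {(v, s)}"

definition loc_map ::
  "('r::comm_ring_1 \<Rightarrow> 'v::ab_group_add \<Rightarrow> 'v) \<Rightarrow> 'r set \<Rightarrow> 'v \<Rightarrow> ('v \<times> 'r) set" where
  "loc_map act S v = loc_frac act S v 1"

lemma loc_rel_iff:
  "((v, s), (w, t)) \<in> loc_rel act S \<longleftrightarrow>
     s \<in> S \<and> t \<in> S \<and> (\<exists>u\<in>S. act u (act t v - act s w) = 0)"
  unfolding loc_rel_def by blast

lemma equiv_loc_rel:
  assumes "module act" and one: "1 \<in> S" and mult: "\<And>s t. s \<in> S \<Longrightarrow> t \<in> S \<Longrightarrow> s * t \<in> S"
  shows "equiv (UNIV \<times> S) (loc_rel act S)"
proof -
  interpret module act by fact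
  have "trans (loc_rel act S)"
  proof (rule transI, safe)
    fix v s w t p r
    assume "((v, s), (w, t)) \<in> loc_rel act S" "((w, t), (p, r)) \<in> loc_rel act S"
    then obtain a b where
      S: "s \<in> S" "t \<in> S" "r \<in> S" "a \<in> S" "b \<in> S"
      and 1: "act a (act t v - act s w) = 0" and 2: "act b (act r w - act t p) = 0"
      unfolding loc_rel_iff by blast
    have "act (a * b * t) (act r v - act s p) =
        (act (a * b * t * r) v - act (a * b * r * s) w) +
        (act (a * b * r * s) w - act (a * b * t * s) p)"
      by (simp add: scale_right_diff_distrib)
    also have "act (a * b * t * r) v - act (a * b * r * s) w = act (b * r) (act a (act t v - act s w))"
      unfolding scale_right_diff_distrib scale_scale by (simp only: ac_simps)
    also have "act (a * b * r * s) w - act (a * b * t * s) p = act (a * s) (act b (act r w - act t p))"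
      unfolding scale_right_diff_distrib scale_scale by (simp only: ac_simps)
    finally have "act (a * b * t) (act r v - act s p) = 0"
      by (simp only: 1 2 scale_zero_right add_0)
    then show "((v, s), (p, r)) \<in> loc_rel act S"
      unfolding loc_rel_iff using S mult by blast
  qed
  moreover have "sym (loc_rel act S)"
  proof (rule symI, safe)
    fix v s w t
    assume "((v, s), (w, t)) \<in> loc_rel act S"
    then obtain u where u: "s \<in> S" "t \<in> S" "u \<in> S" "act u (act t v - act s w) = 0"
      unfolding loc_rel_iff by blast
    have "act u (act s w - act t v) = - act u (act t v - act s w)"
      by (simp only: scale_right_diff_distrib minus_diff_eq)
    then have "act u (act s w - act t v) = 0"
      by (simp only: u minus_zero)
    then show "((w, t), (v, s)) \<in> loc_rel act S"
      unfolding loc_rel_iff using u by blast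
  qed
  moreover have "refl_on (UNIV \<times> S) (loc_rel act S)"
    using one by (auto simp: refl_on_def loc_rel_iff)
  moreover have "loc_rel act S \<subseteq> (UNIV \<times> S) \<times> (UNIV \<times> S)"
    unfolding loc_rel_def by blast
  ultimately show ?thesis
    by (simp add: equiv_def)
qed


section \<open>The \<open>k[x]\<close>-module structure and the localization at the powers of \<open>x\<close>\<close>

definition poly_act ::
  "('k::field \<Rightarrow> 'v::ab_group_add \<Rightarrow> 'v) \<Rightarrow> ('v \<Rightarrow> 'v) \<Rightarrow> 'k poly \<Rightarrow> 'v \<Rightarrow> 'v" where
  "poly_act scale f p v = (\<Sum>i\<le>degree p. scale (coeff p i) ((f ^^ i) v))"

definition x_powers :: "'k::field poly set" where
  "x_powers = range (\<lambda>n. monom 1 1 ^ n)"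

lemma poly_act_eq:
  assumes "vector_space scale" and "degree p \<le> n"
  shows "poly_act scale f p v = (\<Sum>i\<le>n. scale (coeff p i) ((f ^^ i) v))"
proof -
  interpret vector_space scale by fact
  show ?thesis
    unfolding poly_act_def using assms(2)
    by (intro sum.mono_neutral_left) (auto simp: not_le coeff_eq_0)
qed

lemma poly_act_pCons:
  assumes "Vector_Spaces.linear scale scale f"
  shows "poly_act scale f (pCons a p) v = scale a v + f (poly_act scale f p v)"
proof -
  interpret Vector_Spaces.linear scale scale f by fact
  have "poly_act scale f (pCons a p) v
      = (\<Sum>i\<le>Suc (degree p). scale (coeff (pCons a p) i) ((f ^^ i) v))"
    by (intro poly_act_eq vs1.vector_space_axioms degree_pCons_le)
  also have "\<dots> = scale a v + (\<Sum>i\<le>degree p. scale (coeff p i) ((f ^^ Suc i) v))"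
    by (subst sum.atMost_Suc_shift) simp
  also have "\<dots> = scale a v + f (poly_act scale f p v)"
    by (simp add: poly_act_def sum scale)
  finally show ?thesis .
qed

lemma poly_act_x:
  assumes "Vector_Spaces.linear scale scale f"
  shows "poly_act scale f (monom 1 1) v = f v"
proof -
  interpret Vector_Spaces.linear scale scale f by fact
  have x_eq: "monom 1 1 = ([:0, 1:] :: 'a poly)"
    by (simp add: monom_Suc monom_0)
  show ?thesis
    using poly_act_pCons[OF assms, of 0 "[:1:]" v]
    unfolding x_eq by (simp add: poly_act_def)
qed

lemma module_poly_act:
  assumes "Vector_Spaces.linear scale scale f"
  shows "module (poly_act scale f)"
proof -
  interpret Vector_Spaces.linear scale scale f by fact
  note vs = vs1.vector_space_axioms
  have 0: "poly_act scale f 0 v = 0" for v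
    by (simp add: poly_act_def)
  have right: "poly_act scale f p (v + w) = poly_act scale f p v + poly_act scale f p w" for p v w
    by (induction p) (simp_all add: 0 poly_act_pCons[OF assms] add vs1.scale_right_distrib)
  have left: "poly_act scale f (p + q) v = poly_act scale f p v + poly_act scale f q v" for p q v
  proof -
    let ?n = "max (degree p) (degree q)"
    have "poly_act scale f (p + q) v = (\<Sum>i\<le>?n. scale (coeff (p + q) i) ((f ^^ i) v))"
      by (rule poly_act_eq[OF vs degree_add_le_max])
    moreover have "poly_act scale f p v = (\<Sum>i\<le>?n. scale (coeff p i) ((f ^^ i) v))"
      "poly_act scale f q v = (\<Sum>i\<le>?n. scale (coeff q i) ((f ^^ i) v))"
      by (rule poly_act_eq[OF vs]; simp)+
    ultimately show ?thesis
      by (simp add: vs1.scale_left_distrib sum.distrib)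
  qed
  have smult: "poly_act scale f (smult a p) v = scale a (poly_act scale f p v)" for a p v
    by (induction p) (simp_all add: 0 poly_act_pCons[OF assms] scale vs1.scale_right_distrib)
  have mult: "poly_act scale f (p * q) v = poly_act scale f p (poly_act scale f q v)" for p q v
    by (induction p) (simp_all add: 0 left smult poly_act_pCons[OF assms])
  have one: "poly_act scale f 1 v = v" for v
    using poly_act_pCons[OF assms, of 1 0 v] by (simp add: 0 flip: one_pCons)
  show ?thesis
    by unfold_locales (simp_all add: right left mult one)
qed

lemma equiv_loc_rel_x_powers:
  assumes "Vector_Spaces.linear scale scale f"
  shows "equiv (UNIV \<times> x_powers) (loc_rel (poly_act scale f) x_powers)"
proof (rule equiv_loc_rel[OF module_poly_act[OF assms]])
  show "1 \<in> (x_powers :: 'a poly set)"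
    unfolding x_powers_def by (rule range_eqI[of _ _ 0]) simp
  fix s t :: "'a poly"
  assume "s \<in> x_powers" "t \<in> x_powers"
  then obtain i j where "s = monom 1 1 ^ i" "t = monom 1 1 ^ j"
    unfolding x_powers_def by blast
  then have "s * t = monom 1 1 ^ (i + j)"
    by (simp only: power_add)
  then show "s * t \<in> x_powers"
    unfolding x_powers_def by blast
qed


section \<open>Index, core-nilpotency and Drazin inverses\<close>

text \<open>
  The index need not exist, so it is a relation: \<open>has_index f m\<close> says that \<open>i(f)\<close> exists and
  equals \<open>m\<close>.  A linear map is an automorphism iff it is bijective.
\<close>

definition stable_at :: "('v::zero \<Rightarrow> 'v) \<Rightarrow> nat \<Rightarrow> bool" where
  "stable_at f m \<longleftrightarrow>
     {v. (f ^^ m) v = 0} = {v. (f ^^ (m + 1)) v = 0} \<and> range (f ^^ m) = range (f ^^ (m + 1))"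

definition has_index :: "('v::zero \<Rightarrow> 'v) \<Rightarrow> nat \<Rightarrow> bool" where
  "has_index f m \<longleftrightarrow>
     (if bij f then m = 0
      else 0 < m \<and> stable_at f m \<and> (\<forall>j. 0 < j \<and> j < m \<longrightarrow> \<not> stable_at f j))"

definition core_nilpotent ::
  "('k::field \<Rightarrow> 'v::ab_group_add \<Rightarrow> 'v) \<Rightarrow> ('v \<Rightarrow> 'v) \<Rightarrow> bool" where
  "core_nilpotent scale f \<longleftrightarrow>
     (\<exists>f1 f2. Vector_Spaces.linear scale scale f1 \<and> Vector_Spaces.linear scale scale f2 \<and>
        f = (\<lambda>v. f1 v + f2 v) \<and>
        (\<exists>i\<le>1. has_index f1 i) \<and>
        (\<exists>n. f2 ^^ n = (\<lambda>v. 0)) \<and>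
        f1 \<circ> f2 = (\<lambda>v. 0) \<and> f2 \<circ> f1 = (\<lambda>v. 0))"

definition is_pointwise_drazin_inverse ::
  "('k::field \<Rightarrow> 'v::ab_group_add \<Rightarrow> 'v) \<Rightarrow> ('v \<Rightarrow> 'v) \<Rightarrow> ('v \<Rightarrow> 'v) \<Rightarrow> bool" where
  "is_pointwise_drazin_inverse scale f d \<longleftrightarrow>
     Vector_Spaces.linear scale scale d \<and>
     d \<circ> f \<circ> d = d \<and>
     d \<circ> f = f \<circ> d \<and>
     loc_map (poly_act scale f) x_powers \<circ> f \<circ> d = loc_map (poly_act scale f) x_powers"

text \<open>
  The parameter \<open>m\<close> is meant to be the index of \<open>f\<close>.
\<close>

definition is_drazin_inverse ::
  "('k::field \<Rightarrow> 'v::ab_group_add \<Rightarrow> 'v) \<Rightarrow> ('v \<Rightarrow> 'v) \<Rightarrow> nat \<Rightarrow> ('v \<Rightarrow> 'v) \<Rightarrow> bool" where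
  "is_drazin_inverse scale f m D \<longleftrightarrow>
     Vector_Spaces.linear scale scale D \<and>
     D \<circ> f \<circ> D = D \<and>
     D \<circ> f = f \<circ> D \<and>
     (f ^^ (m + 1)) \<circ> D = f ^^ m"

end

theory Submission
  imports Defs
begin

text \<open>
  Two elements of \<open>V\<close> have the same image in the localization \<open>V\<^sub>x\<close> iff some power of \<open>\<phi>\<close> kills
  their difference.  The last axiom of a pointwise Drazin inverse \<open>d\<close> therefore says that each
  vector \<open>\<phi> (d v) - v\<close> is killed by a power of \<open>\<phi>\<close>, with an exponent that may depend on \<open>v\<close>.
  If \<open>\<phi>\<close> has index \<open>m\<close>, the kernels of the powers of \<open>\<phi>\<close> stop growing at \<open>\<phi>\<^sup>m\<close>, so the exponent
  \<open>m\<close> serves for every \<open>v\<close>, and the axiom becomes \<open>\<phi>\<^sup>m\<^sup>+\<^sup>1 \<circ> d = \<phi>\<^sup>m\<close>.  Pointwise Drazin inverses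
  and Drazin inverses are then the same thing (\<open>pointwise_drazin_inverse_iff\<close>).

  Hence it is enough to know that there is exactly one Drazin inverse.  For existence, \<open>\<phi>\<close>
  restricts to an automorphism of \<open>Im \<phi>\<^sup>m\<close>, and \<open>\<phi>\<^sup>m\<close> induces an isomorphism from
  \<open>V / Ker \<phi>\<^sup>m\<close> onto \<open>Im \<phi>\<^sup>m\<close>; the Drazin inverse inverts \<open>\<phi>\<close> on \<open>Im \<phi>\<^sup>m\<close> and vanishes on \<open>Ker \<phi>\<^sup>m\<close>
  (\<open>ex_drazin_inverse\<close>).  Every Drazin inverse \<open>D\<close> takes its values in \<open>Im \<phi>\<^sup>m\<close> and kills \<open>Ker \<phi>\<^sup>m\<close>.
  If \<open>E\<close> is another one, \<open>\<phi> (E v) - v\<close> lies in \<open>Ker \<phi>\<^sup>m\<close>, so \<open>D = D \<circ> \<phi> \<circ> E\<close>; and \<open>D \<circ> \<phi>\<close> fixes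
  \<open>Im \<phi>\<^sup>m\<close> pointwise, so \<open>D \<circ> \<phi> \<circ> E = E\<close> (\<open>drazin_inverse_unique\<close>).
\<close>

locale linear_endomorphism = Vector_Spaces.linear scale scale f
  for scale :: "'k::field \<Rightarrow> 'v::ab_group_add \<Rightarrow> 'v" and f :: "'v \<Rightarrow> 'v"
begin

lemma funpow_add_right: "(f ^^ n) (v + w) = (f ^^ n) v + (f ^^ n) w"
  by (induction n) (simp_all add: add)

lemma funpow_scale_right: "(f ^^ n) (scale c v) = scale c ((f ^^ n) v)"
  by (induction n) (simp_all add: scale)

lemma funpow_diff_right: "(f ^^ n) (v - w) = (f ^^ n) v - (f ^^ n) w"
  by (induction n) (simp_all add: diff)

lemma funpow_zero_right: "(f ^^ n) 0 = 0"
  by (induction n) (simp_all add: zero)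

lemma poly_act_x_power: "poly_act scale f (monom 1 1 ^ n) v = (f ^^ n) v"
proof -
  interpret M: module "poly_act scale f"
    by (rule module_poly_act[OF linear_axioms])
  show ?thesis
    by (induction n) (simp_all add: poly_act_x[OF linear_axioms] del: One_nat_def flip: M.scale_scale)
qed

lemma loc_map_eq_iff:
  "loc_map (poly_act scale f) x_powers v = loc_map (poly_act scale f) x_powers w \<longleftrightarrow>
     (\<exists>n. (f ^^ n) (v - w) = 0)"
proof -
  interpret M: module "poly_act scale f"
    by (rule module_poly_act[OF linear_axioms])
  have one: "1 \<in> (x_powers :: 'k poly set)"
    unfolding x_powers_def by (rule range_eqI[of _ _ 0]) simp
  have "loc_map (poly_act scale f) x_powers v = loc_map (poly_act scale f) x_powers w \<longleftrightarrow>
      ((v, 1), (w, 1)) \<in> loc_rel (poly_act scale f) x_powers"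
    unfolding loc_map_def loc_frac_def
    by (rule eq_equiv_class_iff[OF equiv_loc_rel_x_powers[OF linear_axioms]]) (simp_all add: one)
  also have "\<dots> \<longleftrightarrow> (\<exists>u\<in>x_powers. poly_act scale f u (v - w) = 0)"
    by (simp add: loc_rel_iff one)
  also have "\<dots> \<longleftrightarrow> (\<exists>n. (f ^^ n) (v - w) = 0)"
    by (simp add: x_powers_def poly_act_x_power del: One_nat_def)
  finally show ?thesis .
qed

text \<open>
  Index \<open>0\<close> is set apart by the definition, but it needs no separate treatment afterwards: the
  kernels and images of \<open>f\<^sup>0\<close> and \<open>f\<close> agree precisely when \<open>f\<close> is bijective.
\<close>

lemma stable_at_index:
  assumes "has_index f m"
  shows "stable_at f m"
proof (cases "bij f")
  case True
  then have "f v = 0 \<longleftrightarrow> v = 0" for v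
    using zero by (metis bij_is_inj injD)
  with True assms show ?thesis
    by (auto simp: has_index_def stable_at_def bij_is_surj)
next
  case False
  with assms show ?thesis
    by (simp add: has_index_def)
qed

lemma stable_kernel:
  assumes "stable_at f m" and "(f ^^ (n + m)) v = 0"
  shows "(f ^^ m) v = 0"
  using assms(2)
proof (induction n)
  case (Suc n)
  then have "(f ^^ ((m + 1) + n)) v = 0"
    by (simp add: add.commute[of n])
  then have "(f ^^ (m + 1)) ((f ^^ n) v) = 0"
    by (simp only: funpow_add o_apply)
  then have "(f ^^ m) ((f ^^ n) v) = 0"
    using assms(1) unfolding stable_at_def by blast
  then have "(f ^^ (n + m)) v = 0"
    by (simp add: add.commute[of n] funpow_add)
  then show ?case
    by (rule Suc.IH)
qed simp

lemma stable_range: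
  assumes "stable_at f m"
  shows "range (f ^^ (n + m)) = range (f ^^ m)"
proof (induction n)
  case (Suc n)
  have "range (f ^^ (Suc n + m)) = f ` range (f ^^ (n + m))"
    by (simp add: image_comp)
  also have "\<dots> = range (f ^^ (m + 1))"
    by (simp add: Suc.IH image_comp)
  finally show ?case
    using assms by (simp add: stable_at_def)
qed simp

text \<open>
  Since \<open>Ker f\<^sup>n \<subseteq> Ker f\<^sup>m\<close> for every \<open>n\<close>, the exponent that witnesses equality in the localization
  can be taken to be \<open>m\<close> for all vectors at once.
\<close>

lemma pointwise_drazin_inverse_iff:
  assumes "stable_at f m"
  shows "is_pointwise_drazin_inverse scale f d \<longleftrightarrow> is_drazin_inverse scale f m d"
proof -
  have bounded: "(\<exists>n. (f ^^ n) u = 0) \<longleftrightarrow> (f ^^ m) u = 0" for u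
  proof
    assume "\<exists>n. (f ^^ n) u = 0"
    then obtain n where "(f ^^ n) u = 0" ..
    then have "(f ^^ (n + m)) u = 0"
      by (simp add: add.commute[of n] funpow_add funpow_zero_right)
    then show "(f ^^ m) u = 0"
      by (rule stable_kernel[OF assms])
  qed blast
  have "loc_map (poly_act scale f) x_powers (f (d v)) = loc_map (poly_act scale f) x_powers v
      \<longleftrightarrow> (f ^^ (m + 1)) (d v) = (f ^^ m) v" for v
    unfolding loc_map_eq_iff bounded by (simp add: funpow_diff_right funpow_swap1)
  then show ?thesis
    by (simp add: is_pointwise_drazin_inverse_def is_drazin_inverse_def fun_eq_iff)
qed

text \<open>
  The value at \<open>v\<close> is the \<open>y \<in> Im f\<^sup>m\<close> with \<open>f\<^sup>m\<^sup>+\<^sup>1 y = f\<^sup>m v\<close>.  Stability of the images yields such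
  a \<open>y\<close>, stability of the kernels makes it unique, and uniqueness turns each identity
  required of the Drazin inverse into the verification of these two conditions.
\<close>

lemma ex_drazin_inverse:
  assumes "stable_at f m"
  shows "\<exists>d. is_drazin_inverse scale f m d"
proof -
  have uniq: "y = z"
    if "y \<in> range (f ^^ m)" "z \<in> range (f ^^ m)" "(f ^^ (m + 1)) y = (f ^^ (m + 1)) z" for y z
  proof -
    obtain a b where ab: "y = (f ^^ m) a" "z = (f ^^ m) b"
      using \<open>y \<in> _\<close> \<open>z \<in> _\<close> by blast
    have "(f ^^ ((m + 1) + m)) (a - b) = (f ^^ (m + 1)) y - (f ^^ (m + 1)) z"
      unfolding funpow_diff_right ab by (simp only: funpow_add o_apply)
    then have "(f ^^ m) (a - b) = 0"
      using that(3) by (intro stable_kernel[OF assms, of "m + 1"]) (simp only: diff_self)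
    then show ?thesis
      by (simp add: ab funpow_diff_right)
  qed
  have "\<exists>y. y \<in> range (f ^^ m) \<and> (f ^^ (m + 1)) y = (f ^^ m) v" for v
  proof -
    have "(f ^^ m) v \<in> range (f ^^ ((m + 1) + m))"
      unfolding stable_range[OF assms] by blast
    then show ?thesis
      by (auto simp only: funpow_add o_apply)
  qed
  then obtain d where d_range: "\<And>v. d v \<in> range (f ^^ m)"
    and d_eq: "\<And>v. (f ^^ (m + 1)) (d v) = (f ^^ m) v"
    by metis
  have d_unique: "d v = y" if "y \<in> range (f ^^ m)" "(f ^^ (m + 1)) y = (f ^^ m) v" for v y
    using uniq[OF d_range that(1), of v] that(2) by (simp only: d_eq)
  have range_add: "y + z \<in> range (f ^^ m)" if "y \<in> range (f ^^ m)" "z \<in> range (f ^^ m)" for y z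
    using that by (auto simp flip: funpow_add_right)
  have range_scale: "scale c y \<in> range (f ^^ m)" if "y \<in> range (f ^^ m)" for c y
    using that by (auto simp flip: funpow_scale_right)
  have range_f: "f y \<in> range (f ^^ m)" if "y \<in> range (f ^^ m)" for y
    using that by (auto simp: funpow_swap1)
  have d_add: "d (v + w) = d v + d w" for v w
    by (intro d_unique range_add d_range) (simp only: funpow_add_right d_eq)
  have d_scale: "d (scale c v) = scale c (d v)" for c v
    by (intro d_unique range_scale d_range) (simp only: funpow_scale_right d_eq)
  have d_commute: "d (f v) = f (d v)" for v
    by (intro d_unique range_f d_range) (simp only: d_eq flip: funpow_swap1)
  have d_outer: "d (f (d v)) = d v" for v
    by (intro d_unique d_range) (simp add: funpow_swap1)
  have "Vector_Spaces.linear scale scale d"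
    by unfold_locales (simp_all add: d_add d_scale)
  then show ?thesis
    unfolding is_drazin_inverse_def
    by (intro exI[of _ d]) (auto simp only: fun_eq_iff o_apply d_commute d_outer[unfolded d_commute] d_eq)
qed

text \<open>
  Iterating \<open>D = D \<circ> f \<circ> D\<close> and commuting gives \<open>D = D\<^sup>n\<^sup>+\<^sup>1 \<circ> f\<^sup>n = f\<^sup>n \<circ> D\<^sup>n\<^sup>+\<^sup>1\<close>.  For \<open>n = m\<close> the
  first form shows that \<open>D\<close> kills \<open>Ker f\<^sup>m\<close>, the second that \<open>D\<close> maps into \<open>Im f\<^sup>m\<close>.
\<close>

lemma drazin_inverse_kernel_range:
  assumes "is_drazin_inverse scale f m D"
  shows "(f ^^ m) v = 0 \<Longrightarrow> D v = 0" and "D v \<in> range (f ^^ m)"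
proof -
  interpret D: linear_endomorphism scale D
    using assms by (simp add: linear_endomorphism_def is_drazin_inverse_def)
  have outer: "D (f (D v)) = D v" and commute: "D (f v) = f (D v)" for v
    using assms by (auto simp only: is_drazin_inverse_def fun_eq_iff o_apply)
  have commute_funpow: "(f ^^ n) (D v) = D ((f ^^ n) v)" for n v
    by (induction n) (simp_all add: commute)
  have left: "(D ^^ Suc n) ((f ^^ n) v) = D v" for n v
  proof (induction n arbitrary: v)
    case (Suc n)
    have "(D ^^ Suc (Suc n)) ((f ^^ Suc n) v) = D ((D ^^ Suc n) ((f ^^ n) (f v)))"
      by (simp add: funpow_swap1)
    also have "\<dots> = D v"
      by (simp only: Suc.IH commute[of v] outer)
    finally show ?case .
  qed simp
  have right: "(f ^^ n) ((D ^^ j) v) = (D ^^ j) ((f ^^ n) v)" for n j v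
    by (induction j) (simp_all add: commute_funpow)
  show "D v = 0" if "(f ^^ m) v = 0"
    using left[of m v] that by (simp only: D.funpow_zero_right)
  show "D v \<in> range (f ^^ m)"
    using left[of m v] right[of m "Suc m" v] by (metis rangeI)
qed

lemma drazin_inverse_unique:
  assumes D: "is_drazin_inverse scale f m D" and E: "is_drazin_inverse scale f m E"
  shows "D = E"
proof
  fix v
  interpret D: linear_endomorphism scale D
    using D by (simp add: linear_endomorphism_def is_drazin_inverse_def)
  have D_eq: "(f ^^ m) (f (D v)) = (f ^^ m) v" and E_eq: "(f ^^ m) (f (E v)) = (f ^^ m) v"
    and D_commute: "D (f v) = f (D v)" for v
    using D E by (simp_all add: is_drazin_inverse_def fun_eq_iff funpow_swap1)
  have D_funpow: "D ((f ^^ n) v) = (f ^^ n) (D v)" for n v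
    by (induction n) (simp_all add: D_commute)
  \<comment> \<open>Both sides equal \<open>D (f (E v))\<close>.\<close>
  have "D (f (E v) - v) = 0"
    by (rule drazin_inverse_kernel_range(1)[OF D]) (simp add: funpow_diff_right E_eq)
  then have "D v = D (f (E v))"
    by (simp add: D.diff)
  also obtain w where w: "E v = (f ^^ m) w"
    using drazin_inverse_kernel_range(2)[OF E] by blast
  have "D (f (E v)) = (f ^^ m) (f (D w))"
    unfolding w by (simp add: D_commute D_funpow funpow_swap1)
  also have "\<dots> = E v"
    by (simp add: D_eq w)
  finally show "D v = E v" .
qed

end

theorem proposition5p3:
  fixes scale :: "'k::field \<Rightarrow> 'v::ab_group_add \<Rightarrow> 'v"
    and \<phi> :: "'v \<Rightarrow> 'v"
    and m :: nat
  assumes "vector_space scale"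
    and "Vector_Spaces.linear scale scale \<phi>"
    and "core_nilpotent scale \<phi>"
    and "has_index \<phi> m"
  shows "(\<exists>d. is_pointwise_drazin_inverse scale \<phi> d) \<and>
    (\<forall>d. is_pointwise_drazin_inverse scale \<phi> d \<longrightarrow>
       (\<phi> ^^ (m + 1)) \<circ> d = \<phi> ^^ m \<and>
       is_drazin_inverse scale \<phi> m d \<and>
       (\<forall>D. is_drazin_inverse scale \<phi> m D \<longrightarrow> D = d))"
proof -
  interpret linear_endomorphism scale \<phi>
    using assms(2) by (simp add: linear_endomorphism_def)
  have stable: "stable_at \<phi> m"
    by (rule stable_at_index) fact
  have "is_drazin_inverse scale \<phi> m d \<Longrightarrow> (\<phi> ^^ (m + 1)) \<circ> d = \<phi> ^^ m" for d
    by (simp add: is_drazin_inverse_def)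
  then show ?thesis
    unfolding pointwise_drazin_inverse_iff[OF stable]
    using ex_drazin_inverse[OF stable] drazin_inverse_unique by blast
qed

end
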